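(* Both $A$ and $J$ are integrals of the discrete bicycle transformation: if $V$ and $W$ are closed $k$-gons in $\mathbb{R}^n$ ($n\ge2$) that are in the discrete bicycle correspondence with some length parameter $\ell>0$, i.e. $\mathcal{B}_\ell(V,W)$ holds, then $A(V)=A(W)$ and $J(V)=J(W)$.
   Context: A closed $k$-gon in $\mathbb{R}^n$ is a sequence of points $V_i$ with $V_{i+k}=V_i$ for all $i$. Points are identified with their position vectors. For a closed $k$-gon $V$ define the vector $J(V)$ and the bivector $A(V)\in\Lambda^2\mathbb{R}^n$ by the cyclic sums $$J(V)=\sum_{i=1}^k(|V_{i+1}|^2-|V_{i-1}|^2)V_i=\sum_{i=1}^k|V_i|^2(V_{i-1}-V_{i+1}),\qquad A(V)=\sum_{i=1}^kV_i\wedge V_{i+1}.$$ Discrete bicycle transport. Let $P,Q\in\mathbb{R}^n$, $\ell>0$, $\ell\ne|PQ|$, and let $X$ be a point with $|PX|=\ell$. Parallel translate $X$ along the vector $\overrightarrow{PQ}$ to $U=X+Q-P$ and reflect $U$ in the line $XQ$ (in the plane of $P,Q,X$) to obtain a point $Y$, the transport of $X$ along $PQ$. In terms of unit vectors $u=(X-P)/\ell$ and $v=(Y-Q)/\ell$ one has $v=\frac{2\,u\cdot\xi}{|\xi|^2}\,\xi-u$ with $\xi=(Q-P)-\ell u$. Discrete bicycle correspondence: $\mathcal{B}_\ell(V,W)$ means that for all $i$, $|V_iW_i|=\ell$ and $W_{i+1}$ is the transport of $W_i$ along $V_iV_{i+1}$. The length parameter is taken different from all side lengths of the polygons, so that transports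 are defined. *)

theory Defs
  imports "HOL-Analysis.Analysis"
begin

text \<open>The space of bivectors of \<open>\<real>\<^sup>n\<close> is realised as the space of skew-symmetric
  matrices, with \<open>u \<and> v = u v\<^sup>T - v u\<^sup>T\<close>. The lemmas below show that these matrices are
  exactly the span of the wedge products and that wedge has the universal property of the
  exterior square.\<close>

definition wedge :: "real ^ 'n \<Rightarrow> real ^ 'n \<Rightarrow> real ^ 'n ^ 'n" where
  "wedge u v = (\<chi> i j. u $ i * v $ j - v $ i * u $ j)"

lemma bilinear_wedge: "bilinear (wedge :: real ^ 'n::finite \<Rightarrow> _)"
  by (auto simp: bilinear_def wedge_def vec_eq_iff algebra_simps intro!: linearI)

lemma wedge_self [simp]: "wedge u u = 0"
  by (simp add: wedge_def vec_eq_iff)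

lemma skew_expansion:
  fixes M :: "real ^ 'n::finite ^ 'n"
  assumes "transpose M = - M"
  shows "M = (1/2) *\<^sub>R (\<Sum>i\<in>UNIV. \<Sum>j\<in>UNIV. M $ i $ j *\<^sub>R wedge (axis i 1) (axis j 1))"
proof -
  have sk: "M $ b $ a = - (M $ a $ b)" for a b
  proof -
    have "transpose M $ a $ b = (- M) $ a $ b" by (simp only: assms)
    then show ?thesis by (simp add: transpose_def)
  qed
  have entry: "M $ i $ j *\<^sub>R wedge (axis i 1) (axis j 1) $ a $ b
      = (if j = b then if i = a then M $ i $ j else 0 else 0)
        - (if j = a then if i = b then M $ i $ j else 0 else 0)" for i j a b
    by (auto simp: wedge_def axis_def)
  have "(\<Sum>i\<in>UNIV. \<Sum>j\<in>UNIV. M $ i $ j *\<^sub>R wedge (axis i 1) (axis j 1)) $ a $ b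
      = M $ a $ b - M $ b $ a" for a b
    by (simp only: sum_component vector_scaleR_component entry sum_subtractf
        sum.delta sum.delta' finite UNIV_I if_True)
  then have "(1/2) * (\<Sum>i\<in>UNIV. \<Sum>j\<in>UNIV. M $ i $ j *\<^sub>R wedge (axis i 1) (axis j 1)) $ a $ b
      = M $ a $ b" for a b
    by (simp only: sk[of b a]) simp
  then show ?thesis
    by (simp only: vec_eq_iff vector_scaleR_component real_scaleR_def) simp
qed

lemma span_wedge:
  "span (range (\<lambda>(u, v). wedge u v)) = {M :: real ^ 'n::finite ^ 'n. transpose M = - M}"
proof
  show "span (range (\<lambda>(u, v). wedge u v)) \<subseteq> {M :: real ^ 'n ^ 'n. transpose M = - M}"
  proof (rule span_minimal)
    show "subspace {M :: real ^ 'n ^ 'n. transpose M = - M}"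
    proof (rule subspaceI)
      show "0 \<in> {M :: real ^ 'n ^ 'n. transpose M = - M}"
        by (simp add: transpose_def vec_eq_iff)
    next
      fix x y :: "real ^ 'n ^ 'n" assume "x \<in> {M. transpose M = - M}" "y \<in> {M. transpose M = - M}"
      moreover have "transpose (x + y) = transpose x + transpose y"
        by (simp add: transpose_def vec_eq_iff)
      ultimately show "x + y \<in> {M. transpose M = - M}" by simp
    next
      fix c and x :: "real ^ 'n ^ 'n" assume "x \<in> {M. transpose M = - M}"
      moreover have "transpose (c *\<^sub>R x) = c *\<^sub>R transpose x"
        by (simp add: transpose_def vec_eq_iff)
      ultimately show "c *\<^sub>R x \<in> {M. transpose M = - M}" by simp
    qed
  qed (auto simp: wedge_def transpose_def vec_eq_iff)
  show "{M :: real ^ 'n ^ 'n. transpose M = - M} \<subseteq> span (range (\<lambda>(u, v). wedge u v))"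
  proof
    fix M :: "real ^ 'n ^ 'n" assume "M \<in> {M. transpose M = - M}"
    then have M: "M = (1/2) *\<^sub>R (\<Sum>i\<in>UNIV. \<Sum>j\<in>UNIV. M $ i $ j *\<^sub>R wedge (axis i 1) (axis j 1))"
      using skew_expansion by blast
    have wedge: "wedge (axis i 1) (axis j 1) \<in> span (range (\<lambda>(u, v). wedge u v))" for i j :: 'n
      by (rule span_base, rule range_eqI[of _ _ "(axis i 1, axis j 1)"]) simp
    then show "M \<in> span (range (\<lambda>(u, v). wedge u v))"
      by (subst M) (intro span_scale span_sum wedge)
  qed
qed

lemma wedge_universal:
  fixes f :: "real ^ 'n::finite \<Rightarrow> real ^ 'n \<Rightarrow> 'b::real_vector"
  assumes f: "bilinear f" and alt: "\<And>u. f u u = 0"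
  shows "\<exists>g. linear g \<and> (\<forall>u v. g (wedge u v) = f u v)"
    and "linear g \<Longrightarrow> linear h \<Longrightarrow> (\<And>u v. g (wedge u v) = f u v) \<Longrightarrow>
      (\<And>u v. h (wedge u v) = f u v) \<Longrightarrow> transpose M = - M \<Longrightarrow> g M = h M"
proof -
  have skew: "f v u = - f u v" for u v
    using alt[of "u + v"] alt[of u] alt[of v]
    by (simp add: bilinear_ladd[OF f] bilinear_radd[OF f] eq_neg_iff_add_eq_0 add.commute)
  have ex: "f u v = (\<Sum>i\<in>UNIV. \<Sum>j\<in>UNIV. (u $ i * v $ j) *\<^sub>R f (axis i 1) (axis j 1))" for u v
  proof -
    have b: "w = (\<Sum>i\<in>UNIV. w $ i *\<^sub>R axis i 1)" for w :: "real ^ 'n"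
      using basis_expansion[of w] by (simp add: scalar_mult_eq_scaleR)
    have lin: "linear (\<lambda>x. f x y)" "linear (f x)" for x y
      using f by (auto simp: bilinear_def)
    have "f u v = (\<Sum>i\<in>UNIV. u $ i *\<^sub>R f (axis i 1) v)"
      by (subst b[of u]) (simp add: linear_sum[OF lin(1)] linear_scale[OF lin(1)])
    also have "\<dots> = (\<Sum>i\<in>UNIV. u $ i *\<^sub>R (\<Sum>j\<in>UNIV. v $ j *\<^sub>R f (axis i 1) (axis j 1)))"
      by (subst b[of v]) (simp add: linear_sum[OF lin(2)] linear_scale[OF lin(2)])
    finally show ?thesis by (simp add: scaleR_sum_right)
  qed
  define g where "g = (\<lambda>M :: real ^ 'n ^ 'n.
    (1/2) *\<^sub>R (\<Sum>i\<in>UNIV. \<Sum>j\<in>UNIV. M $ i $ j *\<^sub>R f (axis i 1) (axis j 1)))"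
  have "linear g"
    by (rule linearI)
      (simp_all add: g_def scaleR_left_distrib sum.distrib scaleR_right_distrib
        scaleR_sum_right mult.left_commute add_divide_distrib)
  moreover have "g (wedge u v) = f u v" for u v
  proof -
    have "g (wedge u v) = (1/2) *\<^sub>R (f u v - f v u)"
      by (simp add: g_def ex[of u v] ex[of v u] wedge_def scaleR_left_diff_distrib sum_subtractf)
    also have "f u v - f v u = 2 *\<^sub>R f u v"
      by (simp add: skew[of v u] scaleR_2)
    finally show ?thesis by simp
  qed
  ultimately show "\<exists>g. linear g \<and> (\<forall>u v. g (wedge u v) = f u v)"
    by blast
  show "g M = h M" if g: "linear g" and h: "linear h" and gf: "\<And>u v. g (wedge u v) = f u v"
    and hf: "\<And>u v. h (wedge u v) = f u v" and M: "transpose M = - M" for g h M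
  proof (rule linear_eq_on[OF g h])
    show "M \<in> span (range (\<lambda>(u, v). wedge u v))"
      using M by (simp add: span_wedge)
  qed (auto simp: gf hf)
qed

definition closed_polygon :: "nat \<Rightarrow> (int \<Rightarrow> 'a) \<Rightarrow> bool" where
  "closed_polygon k V \<longleftrightarrow> 0 < k \<and> (\<forall>i. V (i + int k) = V i)"

definition A_bivector :: "nat \<Rightarrow> (int \<Rightarrow> real ^ 'n) \<Rightarrow> real ^ 'n ^ 'n" where
  "A_bivector k V = (\<Sum>i = 1..int k. wedge (V i) (V (i + 1)))"

definition J_vector :: "nat \<Rightarrow> (int \<Rightarrow> 'a::real_normed_vector) \<Rightarrow> 'a" where
  "J_vector k V = (\<Sum>i = 1..int k. ((norm (V (i + 1)))\<^sup>2 - (norm (V (i - 1)))\<^sup>2) *\<^sub>R V i)"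

lemma cyclic_sum_shift:
  fixes f :: "int \<Rightarrow> 'a::ab_group_add"
  assumes "\<And>i. f (i + int k) = f i"
  shows "(\<Sum>i = 1..int k. f (i + 1)) = (\<Sum>i = 1..int k. f i)"
proof (cases "k = 0")
  case False
  have "(\<Sum>i = 1..int k. f (i + 1)) = (\<Sum>i = 2..int k + 1. f i)"
    by (rule sum.reindex_bij_witness[of _ "\<lambda>i. i - 1" "\<lambda>i. i + 1"]) auto
  also have "\<dots> = (\<Sum>i = 2..int k. f i) + f (int k + 1)"
  proof -
    have "{2..int k + 1} = insert (int k + 1) {2..int k}" using False by auto
    then show ?thesis by (simp add: add.commute)
  qed
  also have "f (int k + 1) = f 1"
    using assms[of 1] by (simp add: add.commute)
  also have "(\<Sum>i = 2..int k. f i) + f 1 = (\<Sum>i = 1..int k. f i)"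
  proof -
    have "{1..int k} = insert 1 {2..int k}" using False by auto
    then show ?thesis by (simp add: add.commute)
  qed
  finally show ?thesis .
qed simp

lemma J_vector_alt:
  assumes "closed_polygon k V"
  shows "J_vector k V = (\<Sum>i = 1..int k. (norm (V i))\<^sup>2 *\<^sub>R (V (i - 1) - V (i + 1)))"
proof -
  have V: "V (i + int k) = V i" for i
    using assms by (simp add: closed_polygon_def)
  have V': "V (i + int k + 1) = V (i + 1)" "V (i + int k - 1) = V (i - 1)" for i
    using V[of "i + 1"] V[of "i - 1"] by (simp_all add: algebra_simps)
  have 1: "(\<Sum>i = 1..int k. (norm (V (i + 1)))\<^sup>2 *\<^sub>R V i) = (\<Sum>i = 1..int k. (norm (V i))\<^sup>2 *\<^sub>R V (i - 1))"
    using cyclic_sum_shift[of "\<lambda>i. (norm (V i))\<^sup>2 *\<^sub>R V (i - 1)" k] by (simp add: V V')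
  have 2: "(\<Sum>i = 1..int k. (norm (V (i - 1)))\<^sup>2 *\<^sub>R V i) = (\<Sum>i = 1..int k. (norm (V i))\<^sup>2 *\<^sub>R V (i + 1))"
    using cyclic_sum_shift[of "\<lambda>i. (norm (V (i - 1)))\<^sup>2 *\<^sub>R V i" k] by (simp add: V V')
  show ?thesis
    by (simp add: J_vector_def scaleR_left_diff_distrib scaleR_right_diff_distrib sum_subtractf 1 2)
qed

definition reflect_in_line :: "'a::euclidean_space \<Rightarrow> 'a \<Rightarrow> 'a \<Rightarrow> 'a" where
  "reflect_in_line a b z = 2 *\<^sub>R closest_point (affine hull {a, b}) z - z"

text \<open>Meaningful only if \<open>dist P X \<noteq> dist P Q\<close>, so that \<open>X \<noteq> Q\<close>.\<close>

definition transport :: "'a::euclidean_space \<Rightarrow> 'a \<Rightarrow> 'a \<Rightarrow> 'a" where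
  "transport P Q X = reflect_in_line X Q (X + Q - P)"

text \<open>The length condition that makes the transports meaningful, namely that \<open>l\<close> differs
  from all side lengths, is not part of this definition.\<close>

definition bicycle_corr :: "real \<Rightarrow> (int \<Rightarrow> 'a::euclidean_space) \<Rightarrow> (int \<Rightarrow> 'a) \<Rightarrow> bool" where
  "bicycle_corr l V W \<longleftrightarrow>
    (\<forall>i. dist (V i) (W i) = l \<and> W (i + 1) = transport (V i) (V (i + 1)) (W i))"

lemma reflect_in_line_eq:
  assumes "a \<noteq> b"
  shows "reflect_in_line a b z
    = 2 *\<^sub>R (a + (((z - a) \<bullet> (b - a)) / ((b - a) \<bullet> (b - a))) *\<^sub>R (b - a)) - z"
proof -
  define d where "d = b - a"
  define t where "t = ((z - a) \<bullet> d) / (d \<bullet> d)"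
  have d: "d \<bullet> d \<noteq> 0" using assms by (simp add: d_def)
  have hull: "affine hull {a, b} = {a + s *\<^sub>R d | s. True}"
  proof -
    have "affine hull {a, b} = range (\<lambda>s. a + s *\<^sub>R d)"
      by (simp add: affine_hull_2_alt d_def)
    then show ?thesis by auto
  qed
  have orth: "(z - (a + t *\<^sub>R d)) \<bullet> d = 0"
    using d by (simp add: t_def inner_diff_left inner_add_left)
  have "a + t *\<^sub>R d = closest_point (affine hull {a, b}) z"
  proof (rule closest_point_unique)
    show "convex (affine hull {a, b})" by (simp add: affine_imp_convex)
    show "closed (affine hull {a, b})" by simp
    show "a + t *\<^sub>R d \<in> affine hull {a, b}" by (auto simp: hull)
    show "\<forall>w\<in>affine hull {a, b}. dist z (a + t *\<^sub>R d) \<le> dist z w"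
    proof
      fix w assume "w \<in> affine hull {a, b}"
      then obtain s where w: "w = a + s *\<^sub>R d" by (auto simp: hull)
      have "z - w = (z - (a + t *\<^sub>R d)) + (t - s) *\<^sub>R d"
        by (simp add: w algebra_simps)
      moreover have "orthogonal (z - (a + t *\<^sub>R d)) ((t - s) *\<^sub>R d)"
        using orth by (simp add: orthogonal_def)
      ultimately have "(norm (z - w))\<^sup>2 = (norm (z - (a + t *\<^sub>R d)))\<^sup>2 + (norm ((t - s) *\<^sub>R d))\<^sup>2"
        by (metis norm_add_Pythagorean)
      then have "(norm (z - (a + t *\<^sub>R d)))\<^sup>2 \<le> (norm (z - w))\<^sup>2" by simp
      then show "dist z (a + t *\<^sub>R d) \<le> dist z w"
        unfolding dist_norm by (rule power2_le_imp_le) simp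
    qed
  qed
  then show ?thesis
    by (simp add: reflect_in_line_def t_def d_def)
qed

text \<open>The analytic description of the transport in terms of unit vectors.\<close>

lemma transport_unit_vectors:
  fixes P Q X :: "'a::euclidean_space" and l :: real
  assumes "0 < l" "dist P X = l" "l \<noteq> dist P Q"
  defines "u \<equiv> (1 / l) *\<^sub>R (X - P)"
    and "v \<equiv> (1 / l) *\<^sub>R (transport P Q X - Q)"
    and "\<xi> \<equiv> (Q - P) - (X - P)"
  shows "\<xi> = (Q - P) - l *\<^sub>R u" and "v = (2 * (u \<bullet> \<xi>) / (norm \<xi>)\<^sup>2) *\<^sub>R \<xi> - u"
proof -
  show "\<xi> = (Q - P) - l *\<^sub>R u"
    using assms(1) by (simp add: u_def \<xi>_def)
  have XQ: "X \<noteq> Q" using assms by auto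
  have \<xi>: "\<xi> = Q - X" by (simp add: \<xi>_def)
  have n: "\<xi> \<bullet> \<xi> \<noteq> 0" using XQ by (simp add: \<xi>)
  define x where "x = X - P"
  define c where "c = (x \<bullet> \<xi>) / (\<xi> \<bullet> \<xi>)"
  have e: "((X + Q - P - X) \<bullet> \<xi>) / (\<xi> \<bullet> \<xi>) = c + 1"
  proof -
    have "X + Q - P - X = x + \<xi>" by (simp add: x_def \<xi>)
    then show ?thesis using n by (simp add: c_def inner_add_left add_divide_distrib)
  qed
  have "transport P Q X = 2 *\<^sub>R (X + (c + 1) *\<^sub>R \<xi>) - (X + Q - P)"
    using e unfolding transport_def reflect_in_line_eq[OF XQ] \<xi> by simp
  then have "transport P Q X - Q = (2 * c) *\<^sub>R \<xi> - x"
    by (simp add: x_def \<xi> algebra_simps scaleR_2)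
  then have "v = (1 / l) *\<^sub>R ((2 * c) *\<^sub>R \<xi> - x)"
    by (simp add: v_def)
  then show "v = (2 * (u \<bullet> \<xi>) / (norm \<xi>)\<^sup>2) *\<^sub>R \<xi> - u"
    by (simp add: u_def c_def x_def[symmetric] power2_norm_eq_inner scaleR_right_diff_distrib)
qed

text \<open>Transport preserves side lengths, so a length parameter that differs from all sides
  of \<open>V\<close> also differs from all sides of every \<open>W\<close> corresponding to \<open>V\<close>.\<close>

lemma dist_transport:
  assumes "X \<noteq> Q"
  shows "dist X (transport P Q X) = dist P Q"
proof -
  define d where "d = Q - X"
  define z where "z = Q - P"
  define t where "t = (z \<bullet> d) / (d \<bullet> d)"
  have d: "t * (d \<bullet> d) = z \<bullet> d" using assms by (simp add: d_def t_def)
  have "X + Q - P - X = z" by (simp add: z_def)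
  then have "transport P Q X = 2 *\<^sub>R (X + t *\<^sub>R d) - (X + Q - P)"
    unfolding transport_def reflect_in_line_eq[OF assms] t_def d_def by simp
  then have "X - transport P Q X = z - (2 * t) *\<^sub>R d"
    by (simp add: z_def algebra_simps scaleR_2)
  moreover have "(norm (z - (2 * t) *\<^sub>R d))\<^sup>2 = (norm z)\<^sup>2 + 4 * t * (t * (d \<bullet> d) - z \<bullet> d)"
    by (simp add: power2_norm_eq_inner inner_diff_left inner_diff_right inner_commute algebra_simps)
  ultimately have "(norm (X - transport P Q X))\<^sup>2 = (norm z)\<^sup>2"
    using d by simp
  then show ?thesis
    by (simp add: dist_norm z_def norm_minus_commute)
qed

lemma bicycle_corr_side_lengths:
  assumes "bicycle_corr l V W" "\<And>i. dist (V i) (V (i + 1)) \<noteq> l"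
  shows "dist (W i) (W (i + 1)) = dist (V i) (V (i + 1))"
proof -
  have W: "dist (V i) (W i) = l" "W (i + 1) = transport (V i) (V (i + 1)) (W i)"
    using assms(1) by (auto simp: bicycle_corr_def)
  then have "W i \<noteq> V (i + 1)" using assms(2)[of i] by auto
  then show ?thesis by (simp add: W(2) dist_transport)
qed

end

theory Submission
  imports Defs
begin

text \<open>Lift a point \<open>v\<close> to the point \<open>(v, |v|\<^sup>2)\<close> of the standard paraboloid. Both integrals
  are then cyclic sums \<open>\<Sum> f(V\<^sub>i, V\<^sub>i\<^sub>+\<^sub>1)\<close> over the lifted polygon with \<open>f\<close> bilinear and alternating:
  they are the two parts of \<open>\<Sum> V\<^sub>i \<and> V\<^sub>i\<^sub>+\<^sub>1\<close> under \<open>\<Lambda>\<^sup>2(\<real>\<^sup>n \<times> \<real>) = \<Lambda>\<^sup>2\<real>\<^sup>n \<times> \<real>\<^sup>n\<close>.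

  If \<open>Y\<close> is the transport of \<open>X\<close> along \<open>PQ\<close>, then \<open>P, Q, X, Y\<close> are the vertices of a (possibly
  crossed or degenerate) isosceles trapezoid with parallel lines \<open>PY\<close> and \<open>XQ\<close>. Its axis of
  symmetry is perpendicular to these lines, and so \<open>Y - P = m (Q - X)\<close> persists, with the
  same factor \<open>m\<close>, when the points are lifted (\<open>transport_paraboloid_parallel\<close>). Hence the
  lifted points satisfy \<open>(Y - P) \<and> (Q - X) = 0\<close>, that is,
  \<open>P \<and> Q - X \<and> Y = P \<and> X - Q \<and> Y\<close>. For \<open>P = V\<^sub>i\<close>, \<open>Q = V\<^sub>i\<^sub>+\<^sub>1\<close>, \<open>X = W\<^sub>i\<close>, \<open>Y = W\<^sub>i\<^sub>+\<^sub>1\<close> the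
  right-hand side is the difference of \<open>V\<^sub>i \<and> W\<^sub>i\<close> at consecutive indices, so its cyclic sum
  vanishes (\<open>alternating_cyclic_sum_eq\<close>).\<close>

definition paraboloid :: "'a::real_inner \<Rightarrow> 'a \<times> real" where
  "paraboloid v = (v, v \<bullet> v)"

text \<open>The reflection in \<open>XQ\<close> takes the vector \<open>X - P\<close> to \<open>Y - Q\<close>, so the sum of the two is
  parallel to \<open>XQ\<close>, and therefore so is \<open>Y - P\<close>. The last coordinate is the relation
  \<open>|Y|\<^sup>2 - |P|\<^sup>2 = m (|Q|\<^sup>2 - |X|\<^sup>2)\<close>, which amounts to
  \<open>(Q - X) \<bullet> ((Y + P) - (Q + X)) = 0\<close>: the segment joining the midpoints of the parallel sides
  is perpendicular to them.\<close>

lemma transport_paraboloid_parallel: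
  fixes P Q X :: "'a::euclidean_space"
  assumes "X \<noteq> Q"
  obtains m where
    "paraboloid (transport P Q X) - paraboloid P = m *\<^sub>R (paraboloid Q - paraboloid X)"
proof -
  define d where "d = Q - X"
  define x where "x = X - P"
  define c where "c = (x \<bullet> d) / (d \<bullet> d)"
  define Y where "Y = transport P Q X"
  have dd: "d \<bullet> d \<noteq> 0" using assms by (simp add: d_def)
  have c: "c * (d \<bullet> d) = x \<bullet> d" using dd by (simp add: c_def)
  have "X + Q - P - X = x + d" by (simp add: x_def d_def)
  then have "((X + Q - P - X) \<bullet> (Q - X)) / ((Q - X) \<bullet> (Q - X)) = c + 1"
    using dd by (simp add: c_def d_def[symmetric] inner_add_left add_divide_distrib)
  then have Y: "Y = 2 *\<^sub>R (X + (c + 1) *\<^sub>R d) - (X + Q - P)"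
    unfolding Y_def transport_def reflect_in_line_eq[OF assms] d_def by simp
  have base: "Y - P = (2 * c + 1) *\<^sub>R d"
    by (simp add: Y d_def algebra_simps scaleR_2)
  have midpoints: "Y + P - (Q + X) = (2 * c) *\<^sub>R d - 2 *\<^sub>R x"
    by (simp add: Y d_def x_def algebra_simps scaleR_2)
  have "d \<bullet> (Y + P - (Q + X)) = 2 * (c * (d \<bullet> d) - x \<bullet> d)"
    unfolding midpoints by (simp add: inner_diff_right inner_commute)
  then have axis: "d \<bullet> (Y + P) = d \<bullet> (Q + X)"
    by (simp add: c inner_diff_right)
  have "Y \<bullet> Y - P \<bullet> P = (Y - P) \<bullet> (Y + P)"
    by (simp add: inner_diff_left inner_add_right inner_commute[of P Y])
  also have "\<dots> = (2 * c + 1) * (d \<bullet> (Q + X))"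
    by (simp add: base axis)
  also have "d \<bullet> (Q + X) = Q \<bullet> Q - X \<bullet> X"
    by (simp add: d_def inner_diff_left inner_add_right inner_commute[of X Q])
  finally have "paraboloid Y - paraboloid P = (2 * c + 1) *\<^sub>R (paraboloid Q - paraboloid X)"
    by (simp add: paraboloid_def base d_def)
  then show thesis
    unfolding Y_def by (rule that)
qed

lemma alternating_skew:
  assumes f: "bilinear f" and alt: "\<And>u. f u u = 0"
  shows "f v u = - f u v"
  using alt[of "u + v"] alt[of u] alt[of v]
  by (simp add: bilinear_ladd[OF f] bilinear_radd[OF f] eq_neg_iff_add_eq_0 add.commute)

text \<open>Expanding \<open>f (y - p) (q - x) = 0\<close> for four consecutive points of the two polygons turns
  the difference of the two summands into a difference of consecutive values of
  \<open>f (a i) (b i)\<close>.\<close>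

lemma alternating_cyclic_sum_eq:
  fixes f :: "'a::real_vector \<Rightarrow> 'a \<Rightarrow> 'b::real_vector"
  assumes f: "bilinear f" and alt: "\<And>u. f u u = 0"
    and per: "\<And>i. a (i + int k) = a i" "\<And>i. b (i + int k) = b i"
    and par: "\<And>i. \<exists>m. b (i + 1) - a i = m *\<^sub>R (a (i + 1) - b i)"
  shows "(\<Sum>i = 1..int k. f (a i) (a (i + 1))) = (\<Sum>i = 1..int k. f (b i) (b (i + 1)))"
proof -
  have step: "f (a i) (a (i + 1)) - f (b i) (b (i + 1))
      = f (a i) (b i) - f (a (i + 1)) (b (i + 1))" for i
  proof -
    obtain m where "b (i + 1) - a i = m *\<^sub>R (a (i + 1) - b i)"
      using par by blast
    then have "f (b (i + 1) - a i) (a (i + 1) - b i) = 0"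
      by (simp add: bilinear_lmul[OF f] alt)
    then have "f (b (i + 1)) (a (i + 1)) - f (b (i + 1)) (b i)
        - (f (a i) (a (i + 1)) - f (a i) (b i)) = 0"
      by (simp add: bilinear_lsub[OF f] bilinear_rsub[OF f] algebra_simps)
    then show ?thesis
      unfolding alternating_skew[OF f alt, of "b (i + 1)"]
      by (simp add: algebra_simps)
  qed
  have "(\<Sum>i = 1..int k. f (a i) (a (i + 1))) - (\<Sum>i = 1..int k. f (b i) (b (i + 1)))
      = (\<Sum>i = 1..int k. f (a i) (b i)) - (\<Sum>i = 1..int k. f (a (i + 1)) (b (i + 1)))"
    by (simp add: sum_subtractf[symmetric] step)
  also have "\<dots> = 0"
    using cyclic_sum_shift[of "\<lambda>i. f (a i) (b i)" k] by (simp add: per)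
  finally show ?thesis by simp
qed

text \<open>The universal form of the conservation law: \<open>A\<close> and \<open>J\<close> are instances of it.\<close>

lemma bicycle_corr_alternating_integral:
  fixes f :: "'a::euclidean_space \<times> real \<Rightarrow> 'a \<times> real \<Rightarrow> 'b::real_vector"
  assumes "bilinear f" "\<And>u. f u u = 0"
    and "closed_polygon k V" "closed_polygon k W"
    and sides: "\<And>i. dist (V i) (V (i + 1)) \<noteq> l"
    and corr: "bicycle_corr l V W"
  shows "(\<Sum>i = 1..int k. f (paraboloid (V i)) (paraboloid (V (i + 1))))
    = (\<Sum>i = 1..int k. f (paraboloid (W i)) (paraboloid (W (i + 1))))"
proof (rule alternating_cyclic_sum_eq[OF assms(1,2)])
  fix i
  show "paraboloid (V (i + int k)) = paraboloid (V i)"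
    "paraboloid (W (i + int k)) = paraboloid (W i)"
    using assms(3,4) by (simp_all add: closed_polygon_def)
  have W: "dist (V i) (W i) = l" "W (i + 1) = transport (V i) (V (i + 1)) (W i)"
    using corr by (auto simp: bicycle_corr_def)
  have "W i \<noteq> V (i + 1)" using W(1) sides[of i] by auto
  then show "\<exists>m. paraboloid (W (i + 1)) - paraboloid (V i)
      = m *\<^sub>R (paraboloid (V (i + 1)) - paraboloid (W i))"
    unfolding W(2) by (rule transport_paraboloid_parallel) blast
qed

text \<open>The component of the exterior square of \<open>'a \<times> real\<close> that pairs the vector part of one
  argument with the last coordinate of the other.\<close>

definition mixed_wedge :: "'a::real_vector \<times> real \<Rightarrow> 'a \<times> real \<Rightarrow> 'a" where
  "mixed_wedge p q = snd q *\<^sub>R fst p - snd p *\<^sub>R fst q"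

lemma bilinear_mixed_wedge: "bilinear mixed_wedge"
  by (auto simp: bilinear_def mixed_wedge_def algebra_simps intro!: linearI)

lemma J_vector_eq_mixed_wedge_sum:
  fixes V :: "int \<Rightarrow> 'a::real_inner"
  assumes "closed_polygon k V"
  shows "J_vector k V
    = (\<Sum>i = 1..int k. mixed_wedge (paraboloid (V i)) (paraboloid (V (i + 1))))"
proof -
  have V: "V (i + int k) = V i" for i
    using assms by (simp add: closed_polygon_def)
  have V': "V (i + int k - 1) = V (i - 1)" for i
    using V[of "i - 1"] by (simp add: algebra_simps)
  have "(\<Sum>i = 1..int k. (V (i - 1) \<bullet> V (i - 1)) *\<^sub>R V i)
      = (\<Sum>i = 1..int k. (V i \<bullet> V i) *\<^sub>R V (i + 1))"
    using cyclic_sum_shift[of "\<lambda>i. (V (i - 1) \<bullet> V (i - 1)) *\<^sub>R V i" k] by (simp add: V V')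
  then show ?thesis
    by (simp add: J_vector_def mixed_wedge_def paraboloid_def power2_norm_eq_inner
        scaleR_left_diff_distrib sum_subtractf)
qed

theorem theorem5:
  fixes V W :: "int \<Rightarrow> real ^ 'n" and k :: nat and l :: real
  assumes "CARD('n) \<ge> 2"
    and "closed_polygon k V" and "closed_polygon k W"
    and "l > 0"
    and "\<And>i. dist (V i) (V (i + 1)) \<noteq> l"
    and "bicycle_corr l V W"
  shows "A_bivector k V = A_bivector k W \<and> J_vector k V = J_vector k W"
proof
  have "bilinear (\<lambda>p q :: (real ^ 'n) \<times> real. wedge (fst p) (fst q))"
    using bilinear_wedge
    by (auto simp: bilinear_def linear_iff)
  from bicycle_corr_alternating_integral[OF this _ assms(2,3,5,6)]
  show "A_bivector k V = A_bivector k W"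
    by (simp add: A_bivector_def paraboloid_def)
  show "J_vector k V = J_vector k W"
    unfolding J_vector_eq_mixed_wedge_sum[OF assms(2)] J_vector_eq_mixed_wedge_sum[OF assms(3)]
    by (rule bicycle_corr_alternating_integral[OF bilinear_mixed_wedge _ assms(2,3,5,6)])
      (simp add: mixed_wedge_def)
qed

end
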